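(* Let $f(t),g(t)\in\mathbb{C}[[t]]$ be a delta series and an invertible series respectively, let $(s_n)_{n\ge 0}$ be the Sheffer sequence for $(g(t),f(t))$, and let $r\ge 1$ be an integer. Then the generating function of the Legendre-Gould Hopper based Sheffer polynomials $\frac{{}_{{}_{r}LeG^{(r)}}s_{n}(x,y,z)}{n!}$ reads $$\frac{1}{g(f^{-1}(t))}\,C_0\!\left(x f^{-1}(t)\right)C_0\!\left(-y f^{-1}(t)\right)\exp\!\left(z\,(f^{-1}(t))^r\right)=\sum_{n=0}^{\infty}{}_{{}_{r}LeG^{(r)}}s_{n}(x,y,z)\frac{t^n}{(n!)^2},$$ or, with $A(t)=1/g(f^{-1}(t))$ and $H(t)=f^{-1}(t)$, $$A(t)\,C_0\!\left(x f^{-1}(t)\right)C_0\!\left(-y f^{-1}(t)\right)\exp\!\left(z\,(H(t))^r\right)=\sum_{n=0}^{\infty}{}_{{}_{r}LeG^{(r)}}s_{n}(x,y,z)\frac{t^n}{(n!)^2}.$$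
   Context: A delta series is $f\in\mathbb{C}[[t]]$ with $f(0)=0$, $f'(0)\neq 0$; $f^{-1}$ denotes its compositional inverse. An invertible series is $g\in\mathbb{C}[[t]]$ with $g(0)\ne 0$. The Sheffer sequence for $(g,f)$ is the polynomial sequence $(s_n(x))$ with $\frac{1}{g(f^{-1}(t))}\exp(x f^{-1}(t))=\sum_{n\ge0}s_n(x)\frac{t^n}{n!}$. $C_0(x)=\sum_{k\ge 0}\frac{(-1)^k x^k}{(k!)^2}$ is the Bessel-Tricomi function of order $0$. $D_x^{-1},D_y^{-1}$ are the inverse derivative operators in $x$ and $y$, with $D_x^{-n}\{1\}=x^n/n!$ and $D_y^{-n}\{1\}=y^n/n!$. The polynomials are introduced by replacing the argument of $s_n$ by the multiplicative operator of the Legendre-Gould Hopper polynomials of the second family: $$\frac{{}_{{}_{r}LeG^{(r)}}s_{n}(x,y,z)}{n!}=s_n(\hat M)\{1\},\qquad \hat M=-D_x^{-1}+D_y^{-1}+rz\frac{\partial^{r-1}}{\partial y^{r-1}},$$ where $\{1\}$ means that the resulting operator is applied to the constant $1$. Here the Legendre-Gould Hopper polynomials of the second family, ${}_RH_n^{(r)}(x,y,z)$, are those with $C_0(xt)\,C_0(-yt)\exp(zt^{r})=\sum_{n\ge0}\frac{{}_RH_n^{(r)}(x,y,z)}{n!}\frac{t^n}{n!}$.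
   Formalization: The derivative ∂/∂y in the operator M is taken with respect to D_y^{-1}, i.e. as ∂_y y ∂_y; with the plain ∂/∂y the identity fails for r≥2 (r=2, g=1, f=t, x=0, n=3: y³/6+4yz instead of y³/6+6yz). *)

theory Defs
  imports Complex_Main "HOL-Computational_Algebra.Computational_Algebra"
begin

definition delta_series :: "complex fps \<Rightarrow> bool" where
  "delta_series f \<longleftrightarrow> fps_nth f 0 = 0 \<and> fps_nth f 1 \<noteq> 0"

definition invertible_series :: "complex fps \<Rightarrow> bool" where
  "invertible_series g \<longleftrightarrow> fps_nth g 0 \<noteq> 0"

text \<open>
  The compositional inverse of a delta series is \<open>fps_inv\<close>, and \<open>oo\<close> is substitution of a series
  without constant term. Generating functions are read as formal power series in \<open>t\<close> over the
  complex numbers, for every complex value of the remaining variables.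
\<close>

definition sheffer_sequence :: "complex fps \<Rightarrow> complex fps \<Rightarrow> (nat \<Rightarrow> complex poly) \<Rightarrow> bool" where
  "sheffer_sequence g f s \<longleftrightarrow>
     (\<forall>x. inverse (g oo fps_inv f) * (fps_exp 1 oo (fps_const x * fps_inv f))
          = Abs_fps (\<lambda>n. poly (s n) x / fact n))"

definition bessel_tricomi0 :: "complex fps" where
  "bessel_tricomi0 = Abs_fps (\<lambda>k. (- 1) ^ k / (fact k) ^ 2)"

text \<open>
  Polynomials in \<open>x\<close> and \<open>y\<close> are elements of \<open>complex poly poly\<close>: the outer variable is \<open>y\<close>, the
  inner one is \<open>x\<close>. The variable \<open>z\<close> enters the operators only as a multiplier and is a
  complex parameter.
\<close>

definition eval_xy :: "complex poly poly \<Rightarrow> complex \<Rightarrow> complex \<Rightarrow> complex" where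
  "eval_xy p x y = poly (poly p [:y:]) x"

definition antideriv :: "complex poly \<Rightarrow> complex poly" where
  "antideriv p = (\<Sum>k\<le>degree p. monom (coeff p k / of_nat (Suc k)) (Suc k))"

definition Dx_inv :: "complex poly poly \<Rightarrow> complex poly poly" where
  "Dx_inv p = map_poly antideriv p"

definition Dy_inv :: "complex poly poly \<Rightarrow> complex poly poly" where
  "Dy_inv p = (\<Sum>k\<le>degree p. monom (smult (1 / of_nat (Suc k)) (coeff p k)) (Suc k))"

lemma coeff_antideriv:
  "coeff (antideriv p) k = (if k = 0 then 0 else coeff p (k - 1) / of_nat k)"
proof (cases k)
  case 0
  then show ?thesis by (simp add: antideriv_def coeff_sum)
next
  case (Suc j)
  have "coeff (antideriv p) k = (\<Sum>i\<le>degree p. if i = j then coeff p i / of_nat (Suc i) else 0)"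
    unfolding antideriv_def coeff_sum by (rule sum.cong) (auto simp: Suc)
  also have "\<dots> = (if j \<le> degree p then coeff p j / of_nat (Suc j) else 0)"
    by (subst sum.delta) auto
  also have "\<dots> = coeff p j / of_nat (Suc j)"
    by (auto simp: coeff_eq_0)
  finally show ?thesis by (simp add: Suc)
qed

lemma coeff_Dx_inv: "coeff (Dx_inv p) k = antideriv (coeff p k)"
  unfolding Dx_inv_def by (rule coeff_map_poly) (simp add: antideriv_def)

lemma coeff_Dy_inv:
  "coeff (Dy_inv p) k = (if k = 0 then 0 else smult (1 / of_nat k) (coeff p (k - 1)))"
proof (cases k)
  case 0
  then show ?thesis by (simp add: Dy_inv_def coeff_sum)
next
  case (Suc j)
  have "coeff (Dy_inv p) k
        = (\<Sum>i\<le>degree p. if i = j then smult (1 / of_nat (Suc i)) (coeff p i) else 0)"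
    unfolding Dy_inv_def coeff_sum by (rule sum.cong) (auto simp: Suc)
  also have "\<dots> = (if j \<le> degree p then smult (1 / of_nat (Suc j)) (coeff p j) else 0)"
    by (subst sum.delta) auto
  also have "\<dots> = smult (1 / of_nat (Suc j)) (coeff p j)"
    by (auto simp: coeff_eq_0)
  finally show ?thesis by (simp add: Suc)
qed

lemma Dx_inv_funpow_1: "(Dx_inv ^^ n) 1 = [:monom (1 / fact n) n:]"
proof (induction n)
  case (Suc n)
  show ?case unfolding funpow.simps comp_def Suc.IH
    by (intro poly_eqI) (auto simp: coeff_Dx_inv coeff_pCons coeff_antideriv field_simps split: nat.splits)
qed (simp add: one_pCons monom_0)

lemma Dy_inv_monom: "Dy_inv (monom [:c:] n) = monom [:c / of_nat (Suc n):] (Suc n)"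
  by (intro poly_eqI) (auto simp: coeff_Dy_inv coeff_pCons split: nat.splits)

lemma Dy_inv_funpow_1: "(Dy_inv ^^ n) 1 = monom [:1 / fact n:] n"
  by (induction n) (simp_all add: Dy_inv_monom one_pCons monom_0 mult.commute del: of_nat_Suc)

lemma pderiv_Dy_inv: "pderiv (Dy_inv p) = p"
  by (intro poly_eqI) (simp add: coeff_pderiv coeff_Dy_inv of_nat_poly del: of_nat_Suc)

lemma pderiv_antideriv: "pderiv (antideriv p) = p"
  by (intro poly_eqI) (simp add: coeff_pderiv coeff_antideriv del: of_nat_Suc)

text \<open>
  The multiplicative operator of the Gould-Hopper polynomials,
  \<open>y + r z \<partial>\<^sup>r\<^sup>-\<^sup>1 / \<partial>y\<^sup>r\<^sup>-\<^sup>1\<close>, becomes that of the second family when \<open>y\<close> is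
  replaced by \<open>- D_x^{-1} + D_y^{-1}\<close>. Hence the derivative in it is with respect to
  \<open>D_y^{-1}\<close>: it maps \<open>D_y^{-k}{1}\<close> to \<open>k D_y^{-(k-1)}{1}\<close> and equals
  \<open>\<partial>_y y \<partial>_y\<close> on polynomials. With the plain derivative in \<open>y\<close> the operator would not be the
  multiplicative operator of the second family for \<open>r \<ge> 2\<close>; both facts are proved below
  (\<open>mult_op_quasi_monomial\<close>, \<open>plain_derivative_not_multiplicative\<close>).
\<close>

definition deriv_Dy_inv :: "complex poly poly \<Rightarrow> complex poly poly" where
  "deriv_Dy_inv p = pderiv (pCons 0 (pderiv p))"

lemma deriv_Dy_inv_funpow_1:
  "deriv_Dy_inv ((Dy_inv ^^ k) 1) = of_nat k * (Dy_inv ^^ (k - 1)) 1"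
proof (cases k)
  case (Suc n)
  have "deriv_Dy_inv (monom [:c:] (Suc n)) = monom [:of_nat (Suc n) ^ 2 * c:] n" for c
    by (intro poly_eqI)
       (auto simp: deriv_Dy_inv_def coeff_pderiv coeff_pCons of_nat_poly power2_eq_square mult_ac
             simp del: of_nat_Suc split: nat.splits)
  then show ?thesis
    unfolding Dy_inv_funpow_1 Suc
    by (simp add: of_nat_poly smult_monom power2_eq_square del: of_nat_Suc)
qed (simp add: deriv_Dy_inv_def one_pCons pderiv_pCons)

definition mult_op :: "nat \<Rightarrow> complex \<Rightarrow> complex poly poly \<Rightarrow> complex poly poly" where
  "mult_op r z p = - Dx_inv p + Dy_inv p + smult [:of_nat r * z:] ((deriv_Dy_inv ^^ (r - 1)) p)"

definition poly_of_op ::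
  "complex poly \<Rightarrow> (complex poly poly \<Rightarrow> complex poly poly) \<Rightarrow> complex poly poly \<Rightarrow> complex poly poly" where
  "poly_of_op p T v = (\<Sum>k\<le>degree p. smult [:coeff p k:] ((T ^^ k) v))"

definition lgh_poly :: "nat \<Rightarrow> nat \<Rightarrow> complex \<Rightarrow> complex \<Rightarrow> complex \<Rightarrow> complex" where
  "lgh_poly r n x y z = (fact n) ^ 2 *
     fps_nth ((bessel_tricomi0 oo (fps_const x * fps_X)) *
              (bessel_tricomi0 oo (- fps_const y * fps_X)) *
              (fps_exp 1 oo (fps_const z * fps_X ^ r))) n"

definition lgh_sheffer ::
  "nat \<Rightarrow> (nat \<Rightarrow> complex poly) \<Rightarrow> nat \<Rightarrow> complex \<Rightarrow> complex \<Rightarrow> complex \<Rightarrow> complex" where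
  "lgh_sheffer r s n x y z = fact n * eval_xy (poly_of_op (s n) (mult_op r z) 1) x y"

lemma coeff_deriv_Dy: "coeff (deriv_Dy_inv p) b = smult (of_nat (Suc b) ^ 2) (coeff p (Suc b))"
  by (simp add: deriv_Dy_inv_def coeff_pderiv coeff_pCons of_nat_poly power2_eq_square del: of_nat_Suc)

lemma coeff_deriv_Dy_funpow:
  "coeff ((deriv_Dy_inv ^^ m) p) b = smult ((fact (b + m) / fact b) ^ 2) (coeff p (b + m))"
proof (induction m arbitrary: b)
  case (Suc m)
  show ?case by (simp add: coeff_deriv_Dy Suc.IH power2_eq_square field_simps del: of_nat_Suc)
qed simp

definition mult_op_coeff :: "nat \<Rightarrow> complex \<Rightarrow> nat \<Rightarrow> nat \<Rightarrow> nat \<Rightarrow> complex" where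
 "mult_op_coeff r z n a b = (if a + b \<le> n \<and> r dvd (n - (a + b)) then
     fact n * (-1)^a / (fact a * fact b)^2 * (z ^ ((n-(a+b)) div r) / fact ((n - (a+b)) div r)) else 0)"

lemma coeff_mult_op: "r \<ge> 1 \<Longrightarrow> coeff (coeff ((mult_op r z ^^ n) 1) b) a = mult_op_coeff r z n a b"
proof (induction n arbitrary: a b)
  case 0
  then show ?case by (auto simp: mult_op_coeff_def coeff_pCons one_pCons split: nat.splits)
next
  case (Suc n)
  have IH: "coeff (coeff ((mult_op r z ^^ n) 1) b) a = mult_op_coeff r z n a b" for a b
    using Suc by blast
  have "coeff (coeff ((mult_op r z ^^ Suc n) 1) b) a = 
    - (if a = 0 then 0 else mult_op_coeff r z n (a-1) b / of_nat a) + (if b = 0 then 0 else mult_op_coeff r z n a (b-1) / of_nat b)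
    + of_nat r * z * (fact (b + (r-1)) / fact b) ^ 2 * mult_op_coeff r z n a (b + (r-1))"
    by (simp add: mult_op_def coeff_Dx_inv coeff_antideriv coeff_Dy_inv coeff_deriv_Dy_funpow IH)
  also have "\<dots> = mult_op_coeff r z (Suc n) a b"
  proof (cases "a + b \<le> Suc n \<and> r dvd (Suc n - (a + b))")
    case False
    have 1: "mult_op_coeff r z n (a-1) b = 0" if "a \<noteq> 0" using that False by (cases a) (auto simp: mult_op_coeff_def)
    have 2: "mult_op_coeff r z n a (b-1) = 0" if "b \<noteq> 0" using that False by (cases b) (auto simp: mult_op_coeff_def)
    have 3: "mult_op_coeff r z n a (b+(r-1)) = 0"
    proof (cases "a + (b+(r-1)) \<le> n \<and> r dvd (n - (a + (b+(r-1))))")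
      case True
      then obtain k where k: "n - (a + (b+(r-1))) = r * k" by auto
      hence "Suc n - (a+b) = r * Suc k" using True Suc.prems by (simp add: algebra_simps)
      hence False using False True Suc.prems by (metis dvd_triv_left le_SucI add_leD1 add.assoc)
      thus ?thesis ..
    qed (auto simp: mult_op_coeff_def)
    show ?thesis using 1 2 3 False by (auto simp: mult_op_coeff_def)
  next
    case True
    then obtain c where c: "Suc n - (a+b) = r * c" by auto
    hence n: "Suc n = a + b + r * c" using True by linarith
    define K where "K = fact n * (-1)^a / (fact a * fact b)^2 * (z ^ c / fact c :: complex)"
    have r: "r > 0" using Suc.prems by simp
    have 1: "- (if a = 0 then 0 else mult_op_coeff r z n (a-1) b / of_nat a) = of_nat a * K"
    proof (cases a)
      case (Suc a')
      have e: "n - (a'+b) = r * c" "a' + b \<le> n" using n Suc by auto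
      show ?thesis using r by (simp add: mult_op_coeff_def Suc e K_def field_simps power2_eq_square del: of_nat_Suc)
    qed simp
    have 2: "(if b = 0 then 0 else mult_op_coeff r z n a (b-1) / of_nat b) = of_nat b * K"
    proof (cases b)
      case (Suc a')
      have e: "n - (a+a') = r * c" "a + a' \<le> n" using n Suc by auto
      have q: "mult_op_coeff r z n a a' = fact n * (-1)^a / (fact a * fact a')^2 * (z ^ c / fact c)"
        using r e by (simp add: mult_op_coeff_def)
      show ?thesis by (simp add: q Suc K_def field_simps power2_eq_square del: of_nat_Suc)
    qed simp
    have 3: "of_nat r * z * (fact (b + (r-1)) / fact b) ^ 2 * mult_op_coeff r z n a (b + (r-1)) = of_nat (r * c) * K"
    proof (cases c)
      case 0
      hence "\<not> a + (b+(r-1)) \<le> n \<or> r = 1 \<and> n < a + b" using n r by auto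
      thus ?thesis using 0 n by (auto simp: mult_op_coeff_def)
    next
      case (Suc d)
      have e: "n - (a+(b+(r-1))) = r * d" "a + (b+(r-1)) \<le> n" using n Suc r by auto
      have q: "mult_op_coeff r z n a (b+(r-1)) = fact n * (-1)^a / (fact a * fact (b+(r-1)))^2 * (z ^ d / fact d)"
        using r e by (simp add: mult_op_coeff_def)
      show ?thesis unfolding q K_def
        by (simp add: Suc field_simps power2_eq_square del: of_nat_Suc) (simp add: algebra_simps)
    qed
    have "of_nat a * K + of_nat b * K + of_nat (r*c) * K = of_nat (Suc n) * K"
      unfolding n by (simp add: algebra_simps)
    also have "\<dots> = mult_op_coeff r z (Suc n) a b"
      using True r by (simp add: mult_op_coeff_def c K_def field_simps del: of_nat_Suc)
    finally show ?thesis unfolding 1 2 3 .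
  qed
  finally show ?case .
qed

lemma nth_bt: "fps_nth (bessel_tricomi0 oo (fps_const x * fps_X)) n = (-1)^n * x^n / (fact n)^2"
  by (subst fps_compose_linear) (simp add: bessel_tricomi0_def)

lemma nth_exp: assumes "r \<ge> 1"
  shows "fps_nth (fps_exp 1 oo (fps_const z * fps_X ^ r)) n = (if r dvd n then z^(n div r) / fact (n div r) else (0::complex))"
proof -
  have "fps_nth (fps_exp 1 oo (fps_const z * fps_X ^ r)) n = (\<Sum>i=0..n. 1 / fact i * (z^i * (if n = r * i then 1 else 0)))"
    unfolding fps_compose_nth
    by (simp add: power_mult_distrib fps_const_power fps_X_power_nth flip: power_mult)
  also have "\<dots> = (\<Sum>i=0..n. if i = n div r \<and> r dvd n then z^(n div r) / fact (n div r) else 0)"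
    by (rule sum.cong) (use assms in auto)
  also have "\<dots> = (if r dvd n then z^(n div r) / fact (n div r) else (0::complex))"
    by auto
  finally show ?thesis .
qed

lemma poly_upto: "degree p \<le> n \<Longrightarrow> poly p x = (\<Sum>i\<le>n. coeff p i * x ^ i)"
  for p :: "'a::comm_ring_1 poly"
  by (subst (1) poly_as_sum_of_monoms'[of p n, symmetric]) (auto simp: poly_sum poly_monom)

text \<open>\<open>mult_op\<close> takes \<open>H_n / n!\<close> to \<open>H_{n+1} / (n+1)!\<close>, starting from 1, for \<open>H_n = lgh_poly r n\<close>.\<close>

lemma mult_op_quasi_monomial:
  assumes "r \<ge> 1"
  shows "eval_xy ((mult_op r z ^^ n) 1) x y = lgh_poly r n x y z / fact n"
proof -
  define P where "P = (mult_op r z ^^ n) 1"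
  have c: "coeff (coeff P b) a = mult_op_coeff r z n a b" for a b unfolding P_def by (rule coeff_mult_op[OF assms])
  have d1: "degree P \<le> n"
    by (rule degree_le) (auto intro!: poly_eqI simp: c mult_op_coeff_def)
  have d2: "degree (coeff P b) \<le> n" for b
    by (rule degree_le) (auto intro!: poly_eqI simp: c mult_op_coeff_def)
  have "eval_xy P x y = (\<Sum>b\<le>n. (\<Sum>a\<le>n. mult_op_coeff r z n a b * x^a) * y^b)"
    unfolding eval_xy_def poly_upto[OF d1] poly_sum poly_mult poly_upto[OF d2]
    by (simp add: c flip: pCons_one) 
  also have "\<dots> = (\<Sum>(b,a)\<in>{..n}\<times>{..n}. mult_op_coeff r z n a b * x^a * y^b)"
    by (simp add: sum_distrib_right sum.cartesian_product)
  also have "\<dots> = (\<Sum>(b,a)\<in>{(b,a). a + b \<le> n}. mult_op_coeff r z n a b * x^a * y^b)"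
    by (rule sum.mono_neutral_right) (auto simp: mult_op_coeff_def split: if_splits)
  also have "\<dots> = (\<Sum>(i,a)\<in>(SIGMA i:{0..n}. {0..i}). mult_op_coeff r z n a (i-a) * x^a * y^(i-a))"
    by (rule sum.reindex_bij_witness[of _ "\<lambda>(i,a). (i-a,a)" "\<lambda>(b,a). (a+b,a)"]) auto
  also have "\<dots> = (\<Sum>i=0..n. \<Sum>a=0..i. mult_op_coeff r z n a (i-a) * x^a * y^(i-a))"
    by (simp add: sum.Sigma)
  also have "\<dots> = lgh_poly r n x y z / fact n"
  proof -
    have m: "bessel_tricomi0 oo (- fps_const y * fps_X) = bessel_tricomi0 oo (fps_const (-y) * fps_X)"
      by simp
    have minus_one_mult_uminus_power: "(- 1) ^ k * (- y) ^ k = y ^ k" for k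
      by (simp flip: power_mult_distrib)
    show ?thesis
      unfolding lgh_poly_def m fps_mult_nth nth_bt nth_exp[OF assms]
      unfolding sum_distrib_left sum_distrib_right sum_divide_distrib
      by (intro sum.cong refl)
         (auto simp: mult_op_coeff_def field_simps power2_eq_square minus_one_mult_uminus_power)
  qed
  finally show ?thesis unfolding P_def .
qed

lemma plain_derivative_not_multiplicative:
  fixes M :: "complex poly poly \<Rightarrow> complex poly poly"
  defines "M \<equiv> (\<lambda>p. - Dx_inv p + Dy_inv p + smult [:of_nat 2 * 1:] (pderiv p))"
  shows "eval_xy ((M ^^ 3) 1) 0 1 \<noteq> lgh_poly 2 3 0 1 1 / fact 3"
proof -
  have dx: "antideriv 0 = 0" "antideriv [:c:] = [:0,c:]"  "antideriv [:c,d:] = [:0,c,d/2:]"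
     "antideriv [:c,d,e:] = [:0,c,d/2,e/3:]" for c d e
    by (auto intro!: poly_eqI simp: coeff_antideriv coeff_pCons eval_nat_numeral split: nat.splits)
  have Dx: "Dx_inv [:p:] = [:antideriv p:]" "Dx_inv [:p,q:] = [:antideriv p, antideriv q:]"
     "Dx_inv [:p,q,s:] = [:antideriv p, antideriv q, antideriv s:]" for p q s
    by (auto intro!: poly_eqI simp: coeff_Dx_inv coeff_pCons dx split: nat.splits)
  have Dy: "Dy_inv [:p:] = [:0,p:]" "Dy_inv [:p,q:] = [:0,p,smult (1/2) q:]" 
     "Dy_inv [:p,q,s:] = [:0,p,smult (1/2) q,smult (1/3) s:]" for p q s
    by (auto intro!: poly_eqI simp: coeff_Dy_inv coeff_pCons eval_nat_numeral split: nat.splits)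
  have 1: "eval_xy ((M ^^ 3) 1) 0 1 = 25/6"
    by (simp add: eval_nat_numeral M_def one_pCons Dx Dy dx eval_xy_def pderiv_pCons)
  have 2: "lgh_poly 2 3 0 1 1 / fact 3 = 37 / 6"
    unfolding mult_op_quasi_monomial[symmetric, OF one_le_numeral]
    by (simp add: eval_nat_numeral mult_op_def deriv_Dy_inv_def one_pCons Dx Dy dx eval_xy_def pderiv_pCons)
  show ?thesis unfolding 1 2 by simp
qed

end

theory Submission
  imports Defs
begin

text \<open>
  Expanding the Sheffer generating function in powers of \<open>x\<close> gives
  \<open>[x^k] s_n(x) / n! = [t^n] A(t) H(t)^k / k!\<close>. Substituting the operator for \<open>x\<close> replaces
  \<open>x^k\<close> by \<open>lgh_poly r k / k!\<close>, so the series \<open>exp(x t)\<close> turns into the generating function of the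
  Legendre-Gould Hopper polynomials, taken at \<open>t = H(t)\<close>.
\<close>

text \<open>The left side is linear in the coefficients of \<open>L\<close>, with weights depending
  only on \<open>A\<close> and \<open>H\<close>. Used twice, with \<open>L\<close> an exponential
  and with \<open>L\<close> the Legendre-Gould Hopper series, it lets the two expansions be compared
  term by term.\<close>

lemma fps_mult_compose_nth:
  fixes A L H :: "'a::comm_ring_1 fps"
  assumes "fps_nth H 0 = 0"
  shows "fps_nth (A * (L oo H)) n = (\<Sum>k\<le>n. fps_nth L k * fps_nth (A * H ^ k) n)"
proof -
  \<comment> \<open>\<open>H ^ k\<close> has no terms below order k, so the sum may run up to n
    instead of n - i; a bound free of i is what allows the later swap.\<close>
  have "fps_nth (L oo H) (n - i) = (\<Sum>k\<le>n. fps_nth L k * fps_nth (H ^ k) (n - i))" for i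
    unfolding fps_compose_nth
    by (rule sum.mono_neutral_left) (auto simp: startsby_zero_power_prefix[OF assms])
  then have "fps_nth (A * (L oo H)) n
      = (\<Sum>i=0..n. \<Sum>k\<le>n. fps_nth A i * (fps_nth L k * fps_nth (H ^ k) (n - i)))"
    by (simp add: fps_mult_nth sum_distrib_left)
  also have "\<dots> = (\<Sum>k\<le>n. \<Sum>i=0..n. fps_nth A i * (fps_nth L k * fps_nth (H ^ k) (n - i)))"
    by (rule sum.swap)
  also have "\<dots> = (\<Sum>k\<le>n. fps_nth L k * fps_nth (A * H ^ k) n)"
    by (simp add: fps_mult_nth sum_distrib_left mult_ac)
  finally show ?thesis .
qed

text \<open>Substitution is associative here because r \<ge> 1 keeps the inner series free of a
  constant term.\<close>

lemma fps_compose_scaled_power: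
  fixes a H :: "'a::idom fps"
  assumes "fps_nth H 0 = 0" and "r \<ge> 1"
  shows "(a oo (fps_const c * fps_X ^ r)) oo H = a oo (fps_const c * H ^ r)"
proof -
  have "(a oo (fps_const c * fps_X ^ r)) oo H = a oo ((fps_const c * fps_X ^ r) oo H)"
    using assms by (intro fps_compose_assoc[symmetric]) (auto simp: fps_X_power_nth)
  also have "(fps_const c * fps_X ^ r) oo H = fps_const c * H ^ r"
    using assms by (simp add: fps_compose_mult_distrib fps_compose_power[symmetric])
  finally show ?thesis .
qed

lemma fps_inv_nth_0 [simp]: "fps_nth (fps_inv f) 0 = 0"
  by (simp add: fps_inv_def)

text \<open>The defining identity holds at every complex x, and a polynomial over an infinite field
  is determined by its values.\<close>

lemma sheffer_sequence_eq:
  assumes "sheffer_sequence g f s"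
  shows "s n = (\<Sum>k\<le>n. monom (fact n / fact k *
           fps_nth (inverse (g oo fps_inv f) * fps_inv f ^ k) n) k)"
proof -
  define A where "A = inverse (g oo fps_inv f)"
  define H where "H = fps_inv f"
  have H0: "fps_nth H 0 = 0" by (simp add: H_def)
  have "poly (s n) x = poly (\<Sum>k\<le>n. monom (fact n / fact k * fps_nth (A * H ^ k) n) k) x" for x
  proof -
    have "poly (s n) x / fact n = fps_nth (A * (fps_exp 1 oo (fps_const x * H))) n"
      using assms by (simp add: sheffer_sequence_def A_def H_def)
    \<comment> \<open>Moving x into the outer series makes x^k / k! its coefficients, while the
      inner series no longer depends on x.\<close>
    also have "fps_exp 1 oo (fps_const x * H) = fps_exp x oo H"
      using fps_compose_scaled_power[OF H0, of 1 "fps_exp 1" x] by simp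
    also have "fps_nth (A * (fps_exp x oo H)) n = (\<Sum>k\<le>n. x ^ k / fact k * fps_nth (A * H ^ k) n)"
      by (simp add: fps_mult_compose_nth[OF H0])
    finally have "poly (s n) x = fact n * (\<Sum>k\<le>n. x ^ k / fact k * fps_nth (A * H ^ k) n)"
      by (simp add: field_simps)
    then show ?thesis
      by (simp add: poly_sum poly_monom sum_distrib_left mult_ac)
  qed
  then show ?thesis
    unfolding A_def H_def by (intro poly_eq_poly_eq_iff[THEN iffD1] ext)
qed

lemma eval_xy_poly_of_op:
  assumes "degree p \<le> n"
  shows "eval_xy (poly_of_op p T v) x y = (\<Sum>k\<le>n. coeff p k * eval_xy ((T ^^ k) v) x y)"
proof -
  have "eval_xy (poly_of_op p T v) x y = (\<Sum>k\<le>degree p. coeff p k * eval_xy ((T ^^ k) v) x y)"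
    by (simp add: eval_xy_def poly_of_op_def poly_sum)
  also have "\<dots> = (\<Sum>k\<le>n. coeff p k * eval_xy ((T ^^ k) v) x y)"
    using assms by (intro sum.mono_neutral_left) (auto simp: coeff_eq_0)
  finally show ?thesis .
qed

text \<open>One k! comes from the coefficient of \<open>s n\<close> and one from
  \<open>mult_op_quasi_monomial\<close>; the two factors n! come from that coefficient and from the
  definition of \<open>lgh_sheffer\<close>.\<close>

lemma lgh_sheffer_eq:
  assumes "sheffer_sequence g f s" and "r \<ge> 1"
  shows "lgh_sheffer r s n x y z / (fact n) ^ 2 = (\<Sum>k\<le>n. lgh_poly r k x y z / (fact k) ^ 2 *
           fps_nth (inverse (g oo fps_inv f) * fps_inv f ^ k) n)"
proof -
  have s: "coeff (s n) k = (if k \<le> n then fact n / fact k *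
             fps_nth (inverse (g oo fps_inv f) * fps_inv f ^ k) n else 0)" for k
    by (subst sheffer_sequence_eq[OF assms(1)]) (simp add: coeff_sum)
  then have "degree (s n) \<le> n"
    by (intro degree_le) auto
  then have "lgh_sheffer r s n x y z
      = fact n * (\<Sum>k\<le>n. coeff (s n) k * (lgh_poly r k x y z / fact k))"
    by (simp add: lgh_sheffer_def eval_xy_poly_of_op mult_op_quasi_monomial[OF assms(2)])
  then show ?thesis
    by (simp add: s sum_distrib_left sum_divide_distrib power2_eq_square mult_ac)
qed

theorem theorem2p2:
  fixes f g :: "complex fps" and s :: "nat \<Rightarrow> complex poly" and r :: nat and x y z :: complex
  assumes "delta_series f" and "invertible_series g" and "sheffer_sequence g f s" and "r \<ge> 1"
  shows "inverse (g oo fps_inv f)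
           * (bessel_tricomi0 oo (fps_const x * fps_inv f))
           * (bessel_tricomi0 oo (- fps_const y * fps_inv f))
           * (fps_exp 1 oo (fps_const z * fps_inv f ^ r))
         = Abs_fps (\<lambda>n. lgh_sheffer r s n x y z / (fact n) ^ 2)
       \<and> (let A = inverse (g oo fps_inv f); H = fps_inv f in
           A * (bessel_tricomi0 oo (fps_const x * fps_inv f))
             * (bessel_tricomi0 oo (- fps_const y * fps_inv f))
             * (fps_exp 1 oo (fps_const z * H ^ r))
           = Abs_fps (\<lambda>n. lgh_sheffer r s n x y z / (fact n) ^ 2))"
proof -
  define A where "A = inverse (g oo fps_inv f)"
  define H where "H = fps_inv f"
  \<comment> \<open>The claimed product with t in place of \<open>H\<close>; by the definition of
    \<open>lgh_poly\<close>, its coefficients are exactly the weights in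
    \<open>lgh_sheffer_eq\<close>.\<close>
  define L where "L = (bessel_tricomi0 oo (fps_const x * fps_X)) *
    (bessel_tricomi0 oo (- fps_const y * fps_X)) * (fps_exp 1 oo (fps_const z * fps_X ^ r))"
  have H0: "fps_nth H 0 = 0" by (simp add: H_def)
  have C: "(bessel_tricomi0 oo (fps_const c * fps_X)) oo H = bessel_tricomi0 oo (fps_const c * H)"
    for c using fps_compose_scaled_power[OF H0, of 1] by simp
  have "L oo H = (bessel_tricomi0 oo (fps_const x * H)) * (bessel_tricomi0 oo (- fps_const y * H))
      * (fps_exp 1 oo (fps_const z * H ^ r))"
    using C[of x] C[of "- y"] fps_compose_scaled_power[OF H0 assms(4), of "fps_exp 1" z]
    by (simp add: L_def fps_compose_mult_distrib[OF H0])
  moreover have "A * (L oo H) = Abs_fps (\<lambda>n. lgh_sheffer r s n x y z / (fact n) ^ 2)"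
  proof (rule fps_ext)
    fix n
    have "fps_nth L k = lgh_poly r k x y z / (fact k) ^ 2" for k
      by (simp add: L_def lgh_poly_def)
    then show "fps_nth (A * (L oo H)) n
        = fps_nth (Abs_fps (\<lambda>n. lgh_sheffer r s n x y z / (fact n) ^ 2)) n"
      by (simp add: fps_mult_compose_nth lgh_sheffer_eq[OF assms(3,4)] A_def H_def)
  qed
  ultimately show ?thesis
    by (simp add: A_def H_def Let_def mult.assoc)
qed

end
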